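(* Let $G$ be a self-complementary graph with an antimorphism $\tau$ that is the product of two disjoint circular permutations (whose supports together are $V(G)$), one of them of length $4$. Then at least one of the following holds: $G$ contains the cycle $C_5$ as an induced subgraph; $G$ has a skew partition; $G$ has a symmetric partition.
   Context: Graphs are finite, simple and undirected. An antimorphism of $G$ is a bijection $\tau:V(G)\to V(G)$ such that for all distinct $a,b$, $ab\in E(G)$ if and only if $\tau(a)\tau(b)\notin E(G)$; $G$ is self-complementary if it has an antimorphism. A skew partition of $G$ is a partition $(W,X,Y,Z)$ of $V(G)$ into four non-empty sets such that there are no edges between $W$ and $X$ and every vertex of $Y$ is adjacent to every vertex of $Z$. A symmetric partition of $G$ is a partition $(W,X,Y,Z)$ of $V(G)$ into four non-empty sets such that there are no edges between $W$ and $Z$, no edges between $X$ and $Y$, every vertex of $W$ is adjacent to every vertex of $X$, and every vertex of $Y$ is adjacent to every vertex of $Z$. *)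

theory Defs
  imports
    "Graph_Theory.Digraph_Component"
    "Graph_Theory.Digraph_Isomorphism"
    "HOL-Combinatorics.Cycles"
begin

text \<open>
  A finite simple undirected graph is a \<^locale>\<open>pair_graph\<close>: finite, loop-free, with a symmetric
  set of arcs. Two vertices \<open>u\<close> and \<open>v\<close> are adjacent iff \<open>(u, v)\<close> is an arc, written
  \<open>u \<rightarrow>\<^bsub>G\<^esub> v\<close>.
\<close>

text \<open>Only the values of \<open>\<tau>\<close> on the vertex set matter.\<close>

definition antimorphism :: "'a pair_pre_digraph \<Rightarrow> ('a \<Rightarrow> 'a) \<Rightarrow> bool" where
  "antimorphism G \<tau> \<longleftrightarrow>
     bij_betw \<tau> (pverts G) (pverts G) \<and>
     (\<forall>a\<in>pverts G. \<forall>b\<in>pverts G. a \<noteq> b \<longrightarrow> (a \<rightarrow>\<^bsub>G\<^esub> b \<longleftrightarrow> \<not> \<tau> a \<rightarrow>\<^bsub>G\<^esub> \<tau> b))"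

definition self_complementary :: "'a pair_pre_digraph \<Rightarrow> bool" where
  "self_complementary G \<longleftrightarrow> (\<exists>\<tau>. antimorphism G \<tau>)"

text \<open>Intended for \<open>n \<ge> 3\<close>; smaller values do not give a simple cycle.\<close>

definition cycle_graph :: "nat \<Rightarrow> nat pair_pre_digraph" where
  "cycle_graph n =
     \<lparr> pverts = {..<n},
       parcs = {(i, j). i < n \<and> j < n \<and> (j = (i + 1) mod n \<or> i = (j + 1) mod n)} \<rparr>"

definition contains_induced :: "'a pair_pre_digraph \<Rightarrow> 'b pair_pre_digraph \<Rightarrow> bool" where
  "contains_induced G K \<longleftrightarrow> (\<exists>H. induced_subgraph H (with_proj G) \<and> digraph_iso H (with_proj K))"

text \<open>
  Partitions into four labelled blocks. The blocks are kept as separate arguments, since the set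
  \<open>{W, X, Y, Z}\<close> would not record that they are different.
\<close>

definition four_partition :: "'a set \<Rightarrow> 'a set \<Rightarrow> 'a set \<Rightarrow> 'a set \<Rightarrow> 'a set \<Rightarrow> bool" where
  "four_partition V W X Y Z \<longleftrightarrow>
     W \<noteq> {} \<and> X \<noteq> {} \<and> Y \<noteq> {} \<and> Z \<noteq> {} \<and>
     W \<inter> X = {} \<and> W \<inter> Y = {} \<and> W \<inter> Z = {} \<and> X \<inter> Y = {} \<and> X \<inter> Z = {} \<and> Y \<inter> Z = {} \<and>
     W \<union> X \<union> Y \<union> Z = V"

definition complete_between :: "'a pair_pre_digraph \<Rightarrow> 'a set \<Rightarrow> 'a set \<Rightarrow> bool" where
  "complete_between G A B \<longleftrightarrow> (\<forall>a\<in>A. \<forall>b\<in>B. a \<rightarrow>\<^bsub>G\<^esub> b)"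

definition no_edges_between :: "'a pair_pre_digraph \<Rightarrow> 'a set \<Rightarrow> 'a set \<Rightarrow> bool" where
  "no_edges_between G A B \<longleftrightarrow> (\<forall>a\<in>A. \<forall>b\<in>B. \<not> a \<rightarrow>\<^bsub>G\<^esub> b)"

definition skew_partition ::
    "'a pair_pre_digraph \<Rightarrow> 'a set \<Rightarrow> 'a set \<Rightarrow> 'a set \<Rightarrow> 'a set \<Rightarrow> bool" where
  "skew_partition G W X Y Z \<longleftrightarrow>
     four_partition (pverts G) W X Y Z \<and> no_edges_between G W X \<and> complete_between G Y Z"

definition symmetric_partition ::
    "'a pair_pre_digraph \<Rightarrow> 'a set \<Rightarrow> 'a set \<Rightarrow> 'a set \<Rightarrow> 'a set \<Rightarrow> bool" where
  "symmetric_partition G W X Y Z \<longleftrightarrow>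
     four_partition (pverts G) W X Y Z \<and>
     no_edges_between G W Z \<and> no_edges_between G X Y \<and>
     complete_between G W X \<and> complete_between G Y Z"

end

theory Submission
  imports Defs
begin

text \<open>
  Index the two cycles of \<open>\<tau>\<close> by the integers, as \<open>c\<^sub>i\<close> (period 4) and \<open>d\<^sub>j\<close> (period \<open>n\<close>), so that
  raising both indices of a pair of distinct vertices by one flips adjacency. This forces \<open>n = 1\<close> or
  \<open>4 dvd n\<close>. If \<open>n = 1\<close>, the graph is the bull or \<open>C\<^sub>5\<close>. Otherwise adjacency of \<open>c\<^sub>i\<close> and \<open>d\<^sub>j\<close> is
  determined by \<open>F = {r. c\<^sub>0 ~ d\<^sub>r}\<close>, which is a union of classes modulo 4. If \<open>F\<close> contains or misses
  all indices of one parity, then the parity classes of both cycles form a skew partition. Otherwise,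
  after a shift of the \<open>d\<^sub>j\<close>, \<open>F\<close> consists of the classes 0 and 1. Let \<open>g s\<close> say that \<open>d\<^sub>0 ~ d\<^sub>s\<close>. If
  \<open>g\<close> is constant on \<open>s mod 4 = 1\<close>, then suitable unions of classes modulo 4 form a
  symmetric partition. If not, there are \<open>s\<close> and \<open>x\<close> with \<open>4 dvd x\<close> and \<open>g (s - x) = g (s + x) \<noteq> g s\<close>;
  then \<open>d\<^sub>0, d\<^sub>x, d\<^sub>s, d\<^sub>s\<^sub>+\<^sub>x\<close> induce a path, which is closed to an induced 5-cycle by \<open>c\<^sub>1\<close> or \<open>c\<^sub>3\<close>.
\<close>

section \<open>Functions on the integers\<close>

lemma alternating_int:
  fixes P :: "int \<Rightarrow> bool"
  assumes "\<And>i. P (i + 1) \<longleftrightarrow> \<not> P i"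
  shows "P m \<longleftrightarrow> (P 0 \<noteq> odd m)"
proof (induction m rule: int_induct[where k = 0])
  case (step2 i)
  then show ?case using assms[of "i - 1"] by auto
qed (use assms in auto)

lemma int_function_const:
  fixes h :: "int \<Rightarrow> 'b"
  assumes "\<And>i. h (i + 1) = h i"
  shows "h m = h 0"
proof (induction m rule: int_induct[where k = 0])
  case (step2 i)
  then show ?case using assms[of "i - 1"] by simp
qed (use assms in auto)

text \<open>If there were no such centre, then \<open>h (b + x) = h b\<close> whenever
  \<open>h (b - x)\<close> differs from \<open>h b\<close>. A jump from \<open>a\<close> to
  \<open>a + 1\<close> would make \<open>h\<close> constant from \<open>a + 1\<close> on, against
  periodicity.\<close>

lemma periodic_bool_isolated:
  fixes h :: "int \<Rightarrow> bool"
  assumes "k > 0" and periodic: "\<And>m. h (m + k) = h m" and "h u \<noteq> h v"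
  obtains a x where "h (a + x) = h (a - x)" "h a \<noteq> h (a + x)"
proof -
  have "\<exists>a x. h (a + x) = h (a - x) \<and> h a \<noteq> h (a + x)"
  proof (rule ccontr)
    assume "\<not> ?thesis"
    then have no: "h (b + x) = h b" if "h (b - x) \<noteq> h b" for b x
      using that by auto
    have no': "h (b + x) = h b \<or> h (b - x) = h b" for b x
      using no by auto
    obtain a where a: "h (a + 1) \<noteq> h a"
      using int_function_const[of h] \<open>h u \<noteq> h v\<close> by metis
    \<comment> \<open>Equal values at \<open>a - 1\<close> and \<open>a\<close> let reflections
      reach targets of either parity.\<close>
    then have a1: "h (a - 1) = h a"
      using no'[of a 1] by auto
    \<comment> \<open>reflect \<open>a\<close> or \<open>a - 1\<close> in the midpoint of the way to \<open>a + 1 + i\<close>\<close>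
    have run: "h (a + 1 + int i) = h (a + 1)" for i
    proof (induction i rule: less_induct)
      case (less i)
      show ?case
      proof (cases "i = 0")
        case False
        define y where "y = (int i + 1) div 2"
        define x where "x = int i + 1 - y"
        have y: "y \<ge> 1" "y - 1 < int i" "y - x = 0 \<or> y - x = -1"
          using False by (auto simp: y_def x_def)
        have "h (a + y) = h (a + 1)"
          using less[of "nat (y - 1)"] y by auto
        moreover have "h (a + y - x) = h a"
          using y(3) a1 by (metis add.right_neutral add_diff_eq diff_conv_add_uminus)
        ultimately show ?thesis
          using no[of "a + y" x] a by (auto simp: x_def algebra_simps)
      qed simp
    qed
    have "h (a + k) = h (a + 1)"
      using run[of "nat (k - 1)"] \<open>k > 0\<close> by simp
    then show False using periodic[of a] a by simp
  qed
  then show thesis using that by blast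
qed

section \<open>Cyclic indexing of lists\<close>

text \<open>Integer indices let the cycle act as \<open>i + 1\<close> without wrap-around and allow
  negative shifts.\<close>

definition cyclic_nth :: "'a list \<Rightarrow> int \<Rightarrow> 'a" where
  "cyclic_nth xs i = xs ! nat (i mod int (length xs))"

lemma range_cyclic_nth:
  assumes "xs \<noteq> []"
  shows "range (cyclic_nth xs) = set xs"
proof
  have "nat (i mod int (length xs)) < length xs" for i
    using assms by (simp add: nat_less_iff)
  then show "range (cyclic_nth xs) \<subseteq> set xs" by (auto simp: cyclic_nth_def)
next
  show "set xs \<subseteq> range (cyclic_nth xs)"
  proof
    fix v assume "v \<in> set xs"
    then obtain m where "m < length xs" "v = xs ! m" by (auto simp: in_set_conv_nth)
    then have "v = cyclic_nth xs (int m)" by (simp add: cyclic_nth_def)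
    then show "v \<in> range (cyclic_nth xs)" by blast
  qed
qed

lemma cyclic_nth_eq_iff:
  assumes "distinct xs" "xs \<noteq> []"
  shows "cyclic_nth xs i = cyclic_nth xs j \<longleftrightarrow> i mod int (length xs) = j mod int (length xs)"
proof -
  have "nat (m mod int (length xs)) < length xs" "0 \<le> m mod int (length xs)" for m
    using assms(2) by (simp_all add: nat_less_iff)
  then show ?thesis
    unfolding cyclic_nth_def using assms(1) by (metis nth_eq_iff_index_eq eq_nat_nat_iff)
qed

text \<open>Applying the cycle to each entry of its own list rotates the list by one place.\<close>

lemma cycle_of_list_cyclic_nth:
  assumes "distinct xs" "xs \<noteq> []"
  shows "cycle_of_list xs (cyclic_nth xs i) = cyclic_nth xs (i + 1)"
proof -
  define m where "m = nat (i mod int (length xs))"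
  have m: "m < length xs" "int m = i mod int (length xs)"
    using assms(2) by (simp_all add: m_def nat_less_iff)
  have "map (cycle_of_list xs) xs = rotate1 xs"
    using cyclic_rotation[OF assms(1), of 1] by simp
  then have "cycle_of_list xs (xs ! m) = rotate1 xs ! m"
    using m(1) by (metis nth_map)
  also have "\<dots> = xs ! (Suc m mod length xs)"
    using m(1) by (simp add: nth_rotate1)
  also have "Suc m mod length xs = nat ((i + 1) mod int (length xs))"
    using m(2) by (metis mod_add_left_eq nat_int of_nat_Suc zmod_int add.commute)
  finally show ?thesis by (simp add: cyclic_nth_def m_def)
qed

section \<open>Recognizing the three outcomes\<close>

text \<open>The ten conditions settle all ten pairs, so they determine the induced subgraph;
  distinctness of the vertices follows from them.\<close>

lemma five_cycle_induced:
  assumes "pair_graph G"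
    and edges: "(v0, v1) \<in> parcs G" "(v1, v2) \<in> parcs G" "(v2, v3) \<in> parcs G"
      "(v3, v4) \<in> parcs G" "(v4, v0) \<in> parcs G"
    and non: "(v0, v2) \<notin> parcs G" "(v1, v3) \<notin> parcs G" "(v2, v4) \<notin> parcs G"
      "(v3, v0) \<notin> parcs G" "(v4, v1) \<notin> parcs G"
  shows "contains_induced G (cycle_graph 5)"
proof -
  interpret pair_graph G by fact
  have sym: "(a, b) \<in> parcs G \<longleftrightarrow> (b, a) \<in> parcs G" for a b
    using pair_sym_arcs by (auto simp: symmetric_def dest: symD)
  have irr: "(a, a) \<notin> parcs G" for a
    using no_loops by force
  define S where "S = {v0, v1, v2, v3, v4}"
  define H where "H = \<lparr>pverts = S, parcs = parcs G \<inter> S \<times> S\<rparr>"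
  have SV: "S \<subseteq> pverts G"
    using edges wellformed by (force simp: S_def)
  \<comment> \<open>Adjacent vertices differ as there are no loops. Non-adjacent ones are told apart
    by a third vertex: \<open>v3\<close> is adjacent to \<open>v2\<close> but not to
    \<open>v0\<close>.\<close>
  have dist: "distinct [v0, v1, v2, v3, v4]"
    using edges non sym irr by auto
  have wfH: "wf_digraph (with_proj H)"
    by unfold_locales (auto simp: H_def)
  have wfG: "wf_digraph (with_proj G)" by unfold_locales
  have ind: "induced_subgraph (with_proj H) (with_proj G)"
    unfolding induced_subgraph_def subgraph_def
    using SV wfH wfG by (auto simp: H_def compatible_def)
  define f where "f v = (if v = v0 then 0 else if v = v1 then 1 else if v = v2 then 2
    else if v = v3 then 3 else 4 :: nat)" for v
  have f: "f v0 = 0" "f v1 = 1" "f v2 = 2" "f v3 = 3" "f v4 = 4"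
    using dist by (auto simp: f_def)
  have inj: "inj_on f S" using f by (auto simp: S_def inj_on_def)
  define hom where "hom = \<lparr>iso_verts = f, iso_arcs = map_prod f f, iso_head = snd, iso_tail = fst\<rparr>"
  have hom: "pre_digraph.digraph_isomorphism (with_proj H) hom"
    unfolding pre_digraph.digraph_isomorphism_def
    using wfH inj inj_on_subset[OF map_prod_inj_on[OF inj inj], of "parcs H"]
    by (auto simp: H_def hom_def)
  have rev: "(v1, v0) \<in> parcs G" "(v2, v1) \<in> parcs G" "(v3, v2) \<in> parcs G"
      "(v4, v3) \<in> parcs G" "(v0, v4) \<in> parcs G"
      "(v2, v0) \<notin> parcs G" "(v3, v1) \<notin> parcs G" "(v4, v2) \<notin> parcs G"
      "(v0, v3) \<notin> parcs G" "(v1, v4) \<notin> parcs G"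
    using edges non by (blast dest: sym[THEN iffD1])+
  have parcsH: "parcs H = {(v0, v1), (v1, v0), (v1, v2), (v2, v1), (v2, v3), (v3, v2),
      (v3, v4), (v4, v3), (v4, v0), (v0, v4)}" (is "_ = ?E")
  proof
    show "parcs H \<subseteq> ?E"
    proof
      fix e assume "e \<in> parcs H"
      then obtain a b where "e = (a, b)" "a \<in> S" "b \<in> S" "(a, b) \<in> parcs G"
        by (auto simp: H_def)
      then show "e \<in> ?E"
        unfolding S_def using non rev(6-) irr by (elim insertE emptyE) simp_all
    qed
    show "?E \<subseteq> parcs H"
      using edges rev(1-5) by (simp add: H_def S_def)
  qed
  have parcsC: "parcs (cycle_graph 5) = {(0, 1), (1, 0), (1, 2), (2, 1), (2, 3), (3, 2),
      (3, 4), (4, 3), (4, 0), (0, 4)}"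
    (is "_ = ?E'")
  proof -
    have "(i, j) \<in> parcs (cycle_graph 5) \<longleftrightarrow> (i, j) \<in> ?E'" for i j
    proof (cases "i < 5 \<and> j < 5")
      case True
      then have "i \<in> {0, 1, 2, 3, 4}" "j \<in> {0, 1, 2, 3, 4}" by auto
      then show ?thesis by (elim insertE emptyE) (simp_all add: cycle_graph_def)
    qed (auto simp: cycle_graph_def)
    then show ?thesis
      by (intro set_eqI) (metis surj_pair)
  qed
  have "pverts (cycle_graph 5) = f ` S"
    by (auto simp: cycle_graph_def S_def f)
  moreover have "parcs (cycle_graph 5) = map_prod f f ` parcs H"
    unfolding parcsH parcsC by (simp add: f)
  ultimately have "with_proj (cycle_graph 5) = app_iso hom (with_proj H)"
    by (simp add: with_proj_def app_iso_def hom_def H_def)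
  then show ?thesis
    using ind hom unfolding contains_induced_def digraph_iso_def by blast
qed

section \<open>Antimorphisms with a 4-cycle and another cycle\<close>

text \<open>The antimorphism enters only as the map raising every index by one; the flip conditions
  record its effect on the three kinds of pairs.\<close>

locale antimorphism_two_cycles = pair_graph G
  for G :: "'a pair_pre_digraph" +
  fixes c d :: "int \<Rightarrow> 'a" and n :: int
  assumes verts_eq: "pverts G = range c \<union> range d"
    and n_pos: "n > 0"
    and c_eq_iff: "c i = c j \<longleftrightarrow> i mod 4 = j mod 4"
    and d_eq_iff: "d i = d j \<longleftrightarrow> i mod n = j mod n"
    and c_neq_d: "c i \<noteq> d j"
    and flip_cc: "c i \<noteq> c j \<Longrightarrow> (c (i + 1), c (j + 1)) \<in> parcs G \<longleftrightarrow> (c i, c j) \<notin> parcs G"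
    and flip_cd: "(c (i + 1), d (j + 1)) \<in> parcs G \<longleftrightarrow> (c i, d j) \<notin> parcs G"
    and flip_dd: "d i \<noteq> d j \<Longrightarrow> (d (i + 1), d (j + 1)) \<in> parcs G \<longleftrightarrow> (d i, d j) \<notin> parcs G"
begin

section \<open>Adjacency under index shifts\<close>

lemma edge_sym: "(a, b) \<in> parcs G \<longleftrightarrow> (b, a) \<in> parcs G"
  using pair_sym_arcs by (auto simp: symmetric_def dest: symD)

text \<open>No condition singles out a starting point of the second cycle. This permits normalizing
  the neighbours of \<open>c 0\<close>.\<close>

lemma shift_d: "antimorphism_two_cycles G c (\<lambda>j. d (j + a)) n"
proof -
  have "range (\<lambda>j. d (j + a)) = range d"
  proof
    show "range d \<subseteq> range (\<lambda>j. d (j + a))"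
    proof
      fix v assume "v \<in> range d"
      then obtain j where "v = d j" by blast
      then have "v = d (j - a + a)" by simp
      then show "v \<in> range (\<lambda>j. d (j + a))" by blast
    qed
  qed auto
  moreover have "(i + a) mod n = (j + a) mod n \<longleftrightarrow> i mod n = j mod n" for i j
    by (simp add: mod_eq_dvd_iff)
  ultimately show ?thesis
    using verts_eq n_pos c_neq_d c_eq_iff d_eq_iff flip_cc flip_cd[of _ "_ + a"]
      flip_dd[of "_ + a" "_ + a"]
    by unfold_locales (auto simp: add.assoc add.commute add.left_commute)
qed

text \<open>Distinct vertices stay distinct under a common shift, so each of the \<open>m\<close>
  steps flips adjacency.\<close>

lemma cc_shift:
  assumes "c i \<noteq> c j"
  shows "(c (i + m), c (j + m)) \<in> parcs G \<longleftrightarrow> (((c i, c j) \<in> parcs G) \<noteq> odd m)"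
proof -
  have "c (i + m) \<noteq> c (j + m)" for m
    using assms by (simp add: c_eq_iff mod_eq_dvd_iff)
  from flip_cc[OF this]
  show ?thesis
    using alternating_int[of "\<lambda>m. (c (i + m), c (j + m)) \<in> parcs G" m] by (simp add: add.assoc)
qed

lemma cd_shift:
  "(c (i + m), d (j + m)) \<in> parcs G \<longleftrightarrow> (((c i, d j) \<in> parcs G) \<noteq> odd m)"
  using alternating_int[of "\<lambda>m. (c (i + m), d (j + m)) \<in> parcs G" m] flip_cd
  by (simp flip: add.assoc)

lemma dd_shift:
  assumes "d i \<noteq> d j"
  shows "(d (i + m), d (j + m)) \<in> parcs G \<longleftrightarrow> (((d i, d j) \<in> parcs G) \<noteq> odd m)"
proof -
  have "d (i + m) \<noteq> d (j + m)" for m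
    using assms by (simp add: d_eq_iff mod_eq_dvd_iff)
  from flip_dd[OF this]
  show ?thesis
    using alternating_int[of "\<lambda>m. (d (i + m), d (j + m)) \<in> parcs G" m] by (simp add: add.assoc)
qed

lemma cd_from_c0:
  "(c i, d j) \<in> parcs G \<longleftrightarrow> (((c 0, d (j - i)) \<in> parcs G) \<noteq> odd i)"
  using cd_shift[of 0 i "j - i"] by simp

lemma dd_from_d0:
  assumes "\<not> n dvd j - i"
  shows "(d i, d j) \<in> parcs G \<longleftrightarrow> (((d 0, d (j - i)) \<in> parcs G) \<noteq> odd i)"
  using dd_shift[of 0 "j - i" i] assms by (simp add: d_eq_iff dvd_eq_mod_eq_0)

text \<open>Four steps return \<open>c 0\<close> to itself and, being even in number, preserve
  adjacency.\<close>

lemma c0_period: "(c 0, d (j + 4)) \<in> parcs G \<longleftrightarrow> (c 0, d j) \<in> parcs G"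
proof -
  have "c 4 = c 0" by (simp add: c_eq_iff)
  then show ?thesis using cd_shift[of 0 4 j] by simp
qed

lemma c0_mod4: "(c 0, d j) \<in> parcs G \<longleftrightarrow> (c 0, d (j mod 4)) \<in> parcs G"
proof -
  have step: "(c 0, d (j mod 4 + 4 * (m + 1))) \<in> parcs G \<longleftrightarrow> (c 0, d (j mod 4 + 4 * m)) \<in> parcs G"
    for m
    using c0_period[of "j mod 4 + 4 * m"] by (simp add: algebra_simps)
  have "(c 0, d (j mod 4 + 4 * m)) \<in> parcs G \<longleftrightarrow> (c 0, d (j mod 4 + 4 * 0)) \<in> parcs G" for m
    by (rule int_function_const) (rule step)
  from this[of "j div 4"] show ?thesis by simp
qed

text \<open>A shift by \<open>n\<close> fixes the pair \<open>d 0\<close>, \<open>d 1\<close>, so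
  \<open>n\<close> is even. A shift by \<open>n div 2\<close> swaps \<open>d 0\<close> and
  \<open>d (n div 2)\<close>, so by symmetry of adjacency \<open>n div 2\<close> is even
  too.\<close>

lemma four_dvd_n:
  assumes "n \<noteq> 1"
  shows "4 dvd n"
proof -
  have "d n = d 0" "d (n + 1) = d 1"
    by (simp_all add: d_eq_iff)
  moreover have "d 0 \<noteq> d 1"
    using assms n_pos by (simp add: d_eq_iff)
  ultimately have even: "even n"
    using dd_shift[of 0 1 n] by (auto simp: add.commute)
  define m where "m = n div 2"
  have n: "n = 2 * m" using even by (simp add: m_def)
  have "d 0 \<noteq> d m" using n_pos n by (simp add: d_eq_iff)
  moreover have "d (m + m) = d 0"
    by (simp add: d_eq_iff n)
  ultimately have "even m"
    using dd_shift[of 0 m m] edge_sym[of "d 0" "d m"] by auto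
  then show ?thesis using n by auto
qed

section \<open>Skew partitions from parity classes\<close>

text \<open>Since \<open>n\<close> is even, index parity is well defined on both cycles;
  \<open>q\<close> and \<open>p\<close> select the two classes with no edges between them.\<close>

lemma skew_parity:
  assumes "even n"
    and non: "\<And>i j. even (i - q) \<Longrightarrow> even (j - p) \<Longrightarrow> (c i, d j) \<notin> parcs G"
    and adj: "\<And>i j. odd (i - q) \<Longrightarrow> odd (j - p) \<Longrightarrow> (c i, d j) \<in> parcs G"
  shows "skew_partition G {c i |i. even (i - q)} {d j |j. even (j - p)}
    {c i |i. odd (i - q)} {d j |j. odd (j - p)}"
proof -
  have cpar: "even i \<longleftrightarrow> even j" if "c i = c j" for i j
    using that by (simp add: c_eq_iff) presburger
  have dpar: "even i \<longleftrightarrow> even j" if "d i = d j" for i j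
    using that \<open>even n\<close> by (metis d_eq_iff dvd_mod_iff)
  have "even (q - q)" "even (p - p)" "odd (q + 1 - q)" "odd (p + 1 - p)" by auto
  then have nonempty: "{c i |i. even (i - q)} \<noteq> {}" "{d j |j. even (j - p)} \<noteq> {}"
    "{c i |i. odd (i - q)} \<noteq> {}" "{d j |j. odd (j - p)} \<noteq> {}" by blast+
  have disjoint: "{c i |i. even (i - q)} \<inter> {c i |i. odd (i - q)} = {}"
    "{d j |j. even (j - p)} \<inter> {d j |j. odd (j - p)} = {}"
    by (auto dest: cpar dpar)
  have "{c i |i. P i} \<inter> {d j |j. Q j} = {}" "{d j |j. Q j} \<inter> {c i |i. P i} = {}" for P Q
    using c_neq_d by (auto dest: sym)
  moreover have "{c i |i. even (i - q)} \<union> {d j |j. even (j - p)} \<union> {c i |i. odd (i - q)}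
      \<union> {d j |j. odd (j - p)} = pverts G"
    unfolding verts_eq by blast
  ultimately have "four_partition (pverts G) {c i |i. even (i - q)} {d j |j. even (j - p)}
      {c i |i. odd (i - q)} {d j |j. odd (j - p)}"
    unfolding four_partition_def using nonempty disjoint by blast
  then show ?thesis
    unfolding skew_partition_def no_edges_between_def complete_between_def with_proj_simps
    using non adj by blast
qed

text \<open>A shift by one exchanges the parities in both cycles and flips adjacency. Hence one pair
  of parity classes is complete, the opposite pair has no edges, and \<open>b\<close> tells
  which.\<close>

lemma skew_if_parity_class:
  assumes "even n" and "\<And>j. even (j - p) \<Longrightarrow> (c 0, d j) \<in> parcs G \<longleftrightarrow> b"
  shows "\<exists>W X Y Z. skew_partition G W X Y Z"
proof -
  have *: "(c i, d j) \<in> parcs G \<longleftrightarrow> (b \<noteq> odd i)" if "even (j - i - p)" for i j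
    using that assms(2)[of "j - i"] cd_from_c0[of i j] by auto
  show ?thesis
  proof (cases b)
    case True
    have "skew_partition G {c i |i. even (i - 1)} {d j |j. even (j - (p + 1))}
      {c i |i. odd (i - 1)} {d j |j. odd (j - (p + 1))}"
      by (rule skew_parity[OF \<open>even n\<close>]) (auto simp: * True)
    then show ?thesis by blast
  next
    case False
    have "skew_partition G {c i |i. even (i - 0)} {d j |j. even (j - p)}
      {c i |i. odd (i - 0)} {d j |j. odd (j - p)}"
      by (rule skew_parity[OF \<open>even n\<close>]) (auto simp: * False)
    then show ?thesis by blast
  qed
qed

section \<open>Second cycle of length one\<close>

text \<open>The \<open>c i\<close> induce a path on four vertices. The fixed vertex
  \<open>d 0\<close> is adjacent to alternate indices: either to both ends, giving the 5-cycle, or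
  to both inner vertices, giving the bull.\<close>

lemma c5_or_skew_if_n_1:
  assumes "n = 1"
  shows "contains_induced G (cycle_graph 5) \<or> (\<exists>W X Y Z. skew_partition G W X Y Z)"
proof -
  have d: "d j = d 0" for j by (simp add: d_eq_iff assms)
  have "\<exists>q. (c q, d 0) \<notin> parcs G"
    using flip_cd[of 0 0] d by metis
  then obtain q where q0: "(c q, d 0) \<notin> parcs G" by blast
  have q: "(c (q + m), d 0) \<in> parcs G \<longleftrightarrow> odd m" for m
    using cd_shift[of q m 0] q0 d[of m] by simp
  have ne: "c q \<noteq> c (q + 1)" "c q \<noteq> c (q + 2)" "c q \<noteq> c (q + 3)"
    "c (q + 1) \<noteq> c (q + 2)" "c (q + 1) \<noteq> c (q + 3)" "c (q + 2) \<noteq> c (q + 3)"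
    by (simp_all add: c_eq_iff mod_eq_dvd_iff)
  have c4: "c (q + 4) = c q" by (simp add: c_eq_iff)
  have e12: "(c (q + 1), c (q + 2)) \<in> parcs G \<longleftrightarrow> (c q, c (q + 1)) \<notin> parcs G"
    and e23: "(c (q + 2), c (q + 3)) \<in> parcs G \<longleftrightarrow> (c q, c (q + 1)) \<in> parcs G"
    and e30: "(c (q + 3), c q) \<in> parcs G \<longleftrightarrow> (c q, c (q + 1)) \<notin> parcs G"
    and e13: "(c (q + 1), c (q + 3)) \<in> parcs G \<longleftrightarrow> (c q, c (q + 2)) \<notin> parcs G"
    using cc_shift[OF ne(1), of 1] cc_shift[OF ne(1), of 2] cc_shift[OF ne(1), of 3]
      cc_shift[OF ne(2), of 1] c4
    by (simp_all add: add.assoc)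
  have d1: "(c (q + 1), d 0) \<in> parcs G" and d2: "(c (q + 2), d 0) \<notin> parcs G"
    and d3: "(c (q + 3), d 0) \<in> parcs G"
    using q by auto
  show ?thesis
  proof (cases "(c q, c (q + 2)) \<in> parcs G")
    case True
    have "contains_induced G (cycle_graph 5)"
    proof (cases "(c q, c (q + 1)) \<in> parcs G")
      case True
      then show ?thesis
        using five_cycle_induced[OF pair_graph, of "c (q + 1)" "c q" "c (q + 2)" "c (q + 3)" "d 0"]
          \<open>(c q, c (q + 2)) \<in> parcs G\<close> e12 e23 e30 e13 d1 d2 d3 q0 edge_sym by blast
    next
      case False
      then show ?thesis
        using five_cycle_induced[OF pair_graph, of "c (q + 1)" "c (q + 2)" "c q" "c (q + 3)" "d 0"]
          \<open>(c q, c (q + 2)) \<in> parcs G\<close> e12 e23 e30 e13 d1 d2 d3 q0 edge_sym by blast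
    qed
    then show ?thesis ..
  next
    case False
    have "range c = {c q, c (q + 1), c (q + 2), c (q + 3)}"
    proof -
      have "c i \<in> {c q, c (q + 1), c (q + 2), c (q + 3)}" for i
      proof -
        have "c i = c (q + (i - q) mod 4)"
          by (simp add: c_eq_iff mod_add_right_eq)
        moreover have "(i - q) mod 4 \<in> {0, 1, 2, 3}" by auto
        ultimately show ?thesis by auto
      qed
      then show ?thesis by blast
    qed
    moreover have "range d = {d 0}" using d by auto
    \<comment> \<open>In the bull, removing the adjacent inner vertices \<open>c (q + 1)\<close> and
      \<open>c (q + 3)\<close> separates \<open>c q\<close> from the rest.\<close>
    ultimately have "skew_partition G {c q} {c (q + 2), d 0} {c (q + 1)} {c (q + 3)}"
      using False e13 q0 ne c_neq_d
      by (auto simp: skew_partition_def four_partition_def no_edges_between_def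
          complete_between_def verts_eq c_neq_d[symmetric])
    then show ?thesis by blast
  qed
qed

section \<open>Two consecutive residue classes\<close>

text \<open>A symmetric partition constrains only cyclically consecutive blocks. With the classes of
  the \<open>d j\<close> in cyclic order, only odd differences matter, and difference 3 reduces to 1
  by swapping the vertices.\<close>

lemma c5_or_symmetric_if_two_classes:
  assumes "4 dvd n"
    and F: "\<And>j. (c 0, d j) \<in> parcs G \<longleftrightarrow> j mod 4 = 0 \<or> j mod 4 = 1"
  shows "contains_induced G (cycle_graph 5) \<or> (\<exists>W X Y Z. symmetric_partition G W X Y Z)"
proof -
  have cd: "(c i, d j) \<in> parcs G \<longleftrightarrow> (((j - i) mod 4 = 0 \<or> (j - i) mod 4 = 1) \<noteq> odd i)" for i j
    using cd_from_c0[of i j] F[of "j - i"] by simp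
  define g where "g s \<longleftrightarrow> (d 0, d s) \<in> parcs G" for s
  have n4: "\<not> n dvd x" if "\<not> 4 dvd x" for x
    using that \<open>4 dvd n\<close> dvd_trans by blast
  have dd: "(d i, d j) \<in> parcs G \<longleftrightarrow> (g (j - i) \<noteq> odd i)" if "\<not> n dvd j - i" for i j
    using dd_from_d0[OF that] by (simp add: g_def)
  have cmod: "i mod 4 = j mod 4" if "c i = c j" for i j
    using that by (simp add: c_eq_iff)
  have dmod: "i mod 4 = j mod 4" if "d i = d j" for i j
    using that \<open>4 dvd n\<close> by (metis d_eq_iff mod_mod_cancel)
  define D where "D r = {d j |j. j mod 4 = r}" for r
  define C where "C r r' = {c i |i. i mod 4 = r \<or> i mod 4 = r'}" for r r'
  show ?thesis
  proof (cases "\<exists>b. \<forall>m. g (1 + 4 * m) = b")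
    case True
    then obtain b where "\<And>m. g (1 + 4 * m) = b" by blast
    then have b: "g s = b" if "s mod 4 = 1" for s
      using that by (metis mult_div_mod_eq add.commute)
    have dd1: "(d i, d j) \<in> parcs G \<longleftrightarrow> (b \<noteq> odd i)" if "(j - i) mod 4 = 1" for i j
    proof -
      have "\<not> n dvd j - i" using that by (intro n4) presburger
      then show ?thesis using dd b[OF that] by simp
    qed
    have dd3: "(d i, d j) \<in> parcs G \<longleftrightarrow> (b \<noteq> odd j)" if "(j - i) mod 4 = 3" for i j
    proof -
      have "(i - j) mod 4 = 1" using that by presburger
      then show ?thesis using dd1[of i j] edge_sym by simp
    qed
    \<comment> \<open>Stated through residues alone, adjacency can be evaluated from membership in
      the blocks.\<close>
    have dd1': "(d i, d j) \<in> parcs G \<longleftrightarrow> (b \<noteq> (i mod 4 = 1 \<or> i mod 4 = 3))"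
      if "(j mod 4 - i mod 4) mod 4 = 1" for i j
    proof -
      have "odd i \<longleftrightarrow> i mod 4 = 1 \<or> i mod 4 = 3" by presburger
      then show ?thesis using dd1[of j i] that by (simp add: mod_diff_eq)
    qed
    have dd3': "(d i, d j) \<in> parcs G \<longleftrightarrow> (b \<noteq> (j mod 4 = 1 \<or> j mod 4 = 3))"
      if "(j mod 4 - i mod 4) mod 4 = 3" for i j
    proof -
      have "odd j \<longleftrightarrow> j mod 4 = 1 \<or> j mod 4 = 3" by presburger
      then show ?thesis using dd3[of j i] that by (simp add: mod_diff_eq)
    qed
    have cd': "(c i, d j) \<in> parcs G \<longleftrightarrow>
      ((j mod 4 - i mod 4) mod 4 \<in> {0, 1}) \<noteq> (i mod 4 \<in> {1, 3})" for i j
    proof -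
      have "odd i \<longleftrightarrow> i mod 4 = 1 \<or> i mod 4 = 3" by presburger
      then show ?thesis by (simp add: cd mod_diff_eq)
    qed
    have dc': "(d j, c i) \<in> parcs G \<longleftrightarrow>
      ((j mod 4 - i mod 4) mod 4 \<in> {0, 1}) \<noteq> (i mod 4 \<in> {1, 3})" for i j
      using cd' edge_sym by simp
    have nonempty: "D r \<noteq> {}" if "0 \<le> r" "r < 4" for r
      using that by (auto simp: D_def intro!: exI[of _ r])
    have D_disj: "D r \<inter> D r' = {}" if "r \<noteq> r'" for r r'
      using that by (auto simp: D_def dest: dmod)
    have C_disj: "C r r' \<inter> C p p' = {}" if "{r, r'} \<inter> {p, p'} = {}" for r r' p p'
      using that by (auto simp: C_def dest: cmod)
    have CD_disj: "C r r' \<inter> D p = {}" "D p \<inter> C r r' = {}" for r r' p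
      using c_neq_d c_neq_d[symmetric] by (auto simp: C_def D_def)
    have mod4: "i mod 4 = 0 \<or> i mod 4 = 1 \<or> i mod 4 = 2 \<or> i mod 4 = 3" for i :: int
      by presburger
    have "d i \<in> D 0 \<union> D 1 \<union> D 2 \<union> D 3" "c i \<in> C 0 1 \<union> C 2 3" "c i \<in> C 0 3 \<union> C 1 2" for i
      using mod4[of i] unfolding D_def C_def Un_iff mem_Collect_eq by metis+
    then have ranges: "range d = D 0 \<union> D 1 \<union> D 2 \<union> D 3" "range c = C 0 1 \<union> C 2 3"
      "range c = C 0 3 \<union> C 1 2"
      unfolding D_def C_def by blast+
    have "\<exists>W X Y Z. symmetric_partition G W X Y Z"
    proof (cases b)
      case True
      \<comment> \<open>The \<open>c i\<close> lie only in the opposite blocks W and Y, so edges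
        among them are unconstrained. Those adjacent to \<open>D 1\<close> and not to
        \<open>D 3\<close> join W.\<close>
      have "four_partition (pverts G) (D 0 \<union> C 0 3) (D 1) (D 2 \<union> C 1 2) (D 3)"
        unfolding four_partition_def verts_eq ranges(1,3)
        by (auto simp: nonempty Int_Un_distrib Int_Un_distrib2 D_disj C_disj CD_disj)
      then have "symmetric_partition G (D 0 \<union> C 0 3) (D 1) (D 2 \<union> C 1 2) (D 3)"
        unfolding symmetric_partition_def no_edges_between_def complete_between_def
        using True by (auto simp: D_def C_def dd1' dd3' cd' dc')
      then show ?thesis by blast
    next
      case False
      \<comment> \<open>Negating \<open>b\<close> rotates the classes by one; now W takes the
        \<open>c i\<close> adjacent to \<open>D 0\<close> and not to \<open>D 2\<close>.\<close>
      have "four_partition (pverts G) (D 3 \<union> C 0 1) (D 0) (D 1 \<union> C 2 3) (D 2)"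
        unfolding four_partition_def verts_eq ranges(1,2)
        by (auto simp: nonempty Int_Un_distrib Int_Un_distrib2 D_disj C_disj CD_disj)
      then have "symmetric_partition G (D 3 \<union> C 0 1) (D 0) (D 1 \<union> C 2 3) (D 2)"
        unfolding symmetric_partition_def no_edges_between_def complete_between_def
        using False by (auto simp: D_def C_def dd1' dd3' cd' dc')
      then show ?thesis by blast
    qed
    then show ?thesis ..
  next
    case False
    \<comment> \<open>As \<open>g\<close> has period \<open>n = 4 * k\<close>, its restriction to
      the indices \<open>1 + 4 * m\<close> has period \<open>k\<close> in \<open>m\<close>.\<close>
    define k where "k = n div 4"
    have n: "n = 4 * k" "k > 0" using \<open>4 dvd n\<close> n_pos by (auto simp: k_def)
    have gper: "g (s + n) = g s" for s
      using d_eq_iff[of "s + n" s] by (simp add: g_def)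
    have "g (1 + 4 * (m + k)) = g (1 + 4 * m)" for m
      using gper[of "1 + 4 * m"] n by (simp add: algebra_simps)
    moreover obtain u v where "g (1 + 4 * u) \<noteq> g (1 + 4 * v)"
      using False by metis
    ultimately obtain a y where ay: "g (1 + 4 * (a + y)) = g (1 + 4 * (a - y))"
      "g (1 + 4 * a) \<noteq> g (1 + 4 * (a + y))"
      using periodic_bool_isolated[of k "\<lambda>m. g (1 + 4 * m)"] n(2) by metis
    define s where "s = 1 + 4 * a"
    define x where "x = 4 * y"
    have s: "s mod 4 = 1" and x: "x mod 4 = 0" by (simp_all add: s_def x_def)
    have gs: "g (s + x) = (\<not> g s)" "g (s - x) = (\<not> g s)"
      using ay by (auto simp: s_def x_def algebra_simps)
    have nx: "\<not> n dvd x"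
    proof
      assume "n dvd x"
      then have "d (s + x) = d s" by (simp add: d_eq_iff mod_eq_dvd_iff)
      then show False using gs(1) by (simp add: g_def)
    qed
    have "\<not> n dvd s" "\<not> n dvd s + x" "\<not> n dvd s - x"
      by (rule n4, use s x in presburger)+
    \<comment> \<open>The edges between the pairs \<open>d 0\<close>, \<open>d x\<close> and
      \<open>d s\<close>, \<open>d (s + x)\<close> form a perfect matching. As \<open>s\<close> is
      odd, exactly one of the pairs is itself adjacent.\<close>
    then have edges: "(d 0, d s) \<in> parcs G \<longleftrightarrow> g s" "(d x, d (s + x)) \<in> parcs G \<longleftrightarrow> g s"
      "(d 0, d (s + x)) \<in> parcs G \<longleftrightarrow> \<not> g s" "(d x, d s) \<in> parcs G \<longleftrightarrow> \<not> g s"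
      "(d 0, d x) \<in> parcs G \<longleftrightarrow> g x" "(d s, d (s + x)) \<in> parcs G \<longleftrightarrow> \<not> g x"
      using dd[of s 0] dd[of "s + x" x] dd[of "s + x" 0] dd[of s x] dd[of x 0] dd[of "s + x" s]
        nx gs s x
      by (auto simp: x_def s_def)
    have c1: "(c 1, d 0) \<in> parcs G" "(c 1, d x) \<in> parcs G"
      "(c 1, d s) \<notin> parcs G" "(c 1, d (s + x)) \<notin> parcs G"
      unfolding cd using s x by presburger+
    have c3: "(c 3, d 0) \<notin> parcs G" "(c 3, d x) \<notin> parcs G"
      "(c 3, d s) \<in> parcs G" "(c 3, d (s + x)) \<in> parcs G"
      unfolding cd using s x by presburger+
    have "contains_induced G (cycle_graph 5)"
    \<comment> \<open>The non-adjacent pair forms the ends of the path: \<open>d 0\<close>,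
      \<open>d x\<close>, joined by \<open>c 1\<close>, or \<open>d s\<close>,
      \<open>d (s + x)\<close>, joined by \<open>c 3\<close>. The value of \<open>g s\<close>
      selects the matching.\<close>
    proof (cases "g x"; cases "g s")
      assume "\<not> g x" "g s"
      then show ?thesis
        using edges c1 edge_sym
        by (intro five_cycle_induced[OF pair_graph, of "c 1" "d 0" "d s" "d (s + x)" "d x"]) auto
    next
      assume "\<not> g x" "\<not> g s"
      then show ?thesis
        using edges c1 edge_sym
        by (intro five_cycle_induced[OF pair_graph, of "c 1" "d 0" "d (s + x)" "d s" "d x"]) auto
    next
      assume "g x" "g s"
      then show ?thesis
        using edges c3 edge_sym
        by (intro five_cycle_induced[OF pair_graph, of "c 3" "d s" "d 0" "d x" "d (s + x)"]) auto
    next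
      assume "g x" "\<not> g s"
      then show ?thesis
        using edges c3 edge_sym
        by (intro five_cycle_induced[OF pair_graph, of "c 3" "d s" "d x" "d 0" "d (s + x)"]) auto
    qed
    then show ?thesis ..
  qed
qed

lemma c5_skew_or_symmetric:
  "contains_induced G (cycle_graph 5) \<or> (\<exists>W X Y Z. skew_partition G W X Y Z)
    \<or> (\<exists>W X Y Z. symmetric_partition G W X Y Z)"
proof (cases "n = 1")
  case True
  then show ?thesis using c5_or_skew_if_n_1 by blast
next
  case False
  then have n4: "4 dvd n" by (rule four_dvd_n)
  then have "even n" by auto
  define F where "F j \<longleftrightarrow> (c 0, d j) \<in> parcs G" for j
  have F4: "F j = F (j mod 4)" for j
    unfolding F_def by (rule c0_mod4)
  show ?thesis
  \<comment> \<open>Residues 0 and 2, or 1 and 3, make up one parity class.\<close>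
  proof (cases "F 0 = F 2 \<or> F 1 = F 3")
    case True
    have "F 0 = F (0 + 2) \<or> F 1 = F (1 + 2)"
      using True by simp
    then obtain p where p: "F p = F (p + 2)" by blast
    have "F j = F p" if "even (j - p)" for j
    proof -
      have "j mod 4 = p mod 4 \<or> j mod 4 = (p + 2) mod 4" using that by presburger
      then show ?thesis using p F4 by metis
    qed
    then show ?thesis
      using skew_if_parity_class[OF \<open>even n\<close>] unfolding F_def by metis
  next
    case False
    \<comment> \<open>One residue of each parity lies in \<open>F\<close>, so the two are cyclically
      consecutive; \<open>a\<close> is the first.\<close>
    then have "\<exists>a\<in>{0, 1, 2, 3}. F a \<and> F ((a + 1) mod 4) \<and> \<not> F ((a + 2) mod 4) \<and> \<not> F ((a + 3) mod 4)"
      by (cases "F 0"; cases "F 1") simp_all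
    then obtain a where a: "F a" "F ((a + 1) mod 4)" "\<not> F ((a + 2) mod 4)"
      "\<not> F ((a + 3) mod 4)"
      by blast
    interpret shifted: antimorphism_two_cycles G c "\<lambda>j. d (j + a)" n
      by (rule shift_d)
    have "F (j + a) \<longleftrightarrow> j mod 4 = 0 \<or> j mod 4 = 1" for j
    proof -
      have "j mod 4 = 0 \<or> j mod 4 = 1 \<or> j mod 4 = 2 \<or> j mod 4 = 3" by presburger
      moreover have "F (j + a) = F ((j mod 4 + a) mod 4)"
        using F4[of "j + a"] by (metis mod_add_left_eq)
      moreover have "F (a mod 4)" using a(1) F4 by metis
      ultimately show ?thesis
        using a(2-) by (auto simp: add.commute)
    qed
    then show ?thesis
      using shifted.c5_or_symmetric_if_two_classes[OF n4] by (auto simp: F_def)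
  qed
qed

end

section \<open>From list cycles to integer indices\<close>

theorem theorem5:
  fixes G :: "'a pair_pre_digraph" and \<tau> :: "'a \<Rightarrow> 'a" and cs ds :: "'a list"
  assumes "pair_graph G"
    and "self_complementary G"
    and "antimorphism G \<tau>"
    and "cycle cs" and "cycle ds"
    and "length cs = 4" and "ds \<noteq> []"
    and "set cs \<inter> set ds = {}" and "set cs \<union> set ds = pverts G"
    and "\<forall>v\<in>pverts G. \<tau> v = (cycle_of_list cs \<circ> cycle_of_list ds) v"
  shows "contains_induced G (cycle_graph 5)
       \<or> (\<exists>W X Y Z. skew_partition G W X Y Z)
       \<or> (\<exists>W X Y Z. symmetric_partition G W X Y Z)"
proof -
  interpret pair_graph G by fact
  let ?c = "cyclic_nth cs" and ?d = "cyclic_nth ds"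
  have "cs \<noteq> []" using assms(6) by auto
  have range: "range ?c = set cs" "range ?d = set ds"
    using range_cyclic_nth \<open>cs \<noteq> []\<close> \<open>ds \<noteq> []\<close> by auto
  then have mem: "?c i \<in> set cs" "?d i \<in> set ds" for i by blast+
  \<comment> \<open>Each cycle fixes the support of the other, so only one factor of the composition
    moves a given vertex.\<close>
  have tau: "\<tau> (?c i) = ?c (i + 1)" "\<tau> (?d i) = ?d (i + 1)" for i
  proof -
    have "?c i \<notin> set ds" "?d (i + 1) \<notin> set cs"
      using mem assms(8) by blast+
    then show "\<tau> (?c i) = ?c (i + 1)" "\<tau> (?d i) = ?d (i + 1)"
      using mem assms(4,5,10) \<open>cs \<noteq> []\<close> \<open>ds \<noteq> []\<close> unfolding assms(9)[symmetric]
      by (simp_all add: id_outside_supp cycle_of_list_cyclic_nth)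
  qed
  have flip: "(\<tau> a, \<tau> b) \<in> parcs G \<longleftrightarrow> (a, b) \<notin> parcs G"
    if "a \<in> pverts G" "b \<in> pverts G" "a \<noteq> b" for a b
    using assms(3) that by (auto simp: antimorphism_def)
  have cd: "?c i \<noteq> ?d j" for i j using mem assms(8) by (metis disjoint_iff)
  have memV: "?c i \<in> pverts G" "?d i \<in> pverts G" for i using mem assms(9) by auto
  interpret antimorphism_two_cycles G ?c ?d "int (length ds)"
  proof
    show "pverts G = range ?c \<union> range ?d" using range assms(9) by simp
    show "0 < int (length ds)" using \<open>ds \<noteq> []\<close> by simp
    show "?c i = ?c j \<longleftrightarrow> i mod 4 = j mod 4" for i j
      using cyclic_nth_eq_iff[OF assms(4) \<open>cs \<noteq> []\<close>] assms(6) by simp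
    show "?d i = ?d j \<longleftrightarrow> i mod int (length ds) = j mod int (length ds)" for i j
      using cyclic_nth_eq_iff[OF assms(5) \<open>ds \<noteq> []\<close>] .
  qed (use cd flip memV in \<open>simp_all flip: tau\<close>)
  show ?thesis by (rule c5_skew_or_symmetric)
qed

end
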